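(* Let $f$ be a PWL orientation preserving homeomorphism of the circle with rational rotation number $p/q$. Then $f$ is conjugate to the rigid rational rotation $r_{p/q}$, $r_{p/q}(x)=x+\frac{p}{q}\ (\mathrm{mod}\ 1)$, by a PWL homeomorphism if and only if every break point of $f$ is periodic under $f$.
   Context: The circle $\mathbb{S}^1=\mathbb{R}/\mathbb{Z}$ is parametrized by $x\in[0,1)$. An orientation preserving homeomorphism $f$ of the circle is described by a lift $F:\mathbb{R}\to\mathbb{R}$, continuous and strictly increasing with $F(x+1)=F(x)+1$ and $f(x)=F(x)\ (\mathrm{mod}\ 1)$; two lifts of $f$ differ by an integer. $f$ is piecewise linear (PWL) if there is a finite set of break points $0\le b_1<b_2<\dots<b_n<1$ such that $F$ is affine on each interval $(b_i,b_{i+1})$, $1\le i\le n-1$, and on $(b_n,b_1+1)$, and at each break point the left and right derivatives differ: $F'(b_{i,-})=\lim_{x\uparrow b_i}F'(x)\neq\lim_{x\downarrow b_i}F'(x)=F'(b_{i,+})$. (A PWL map has $n\ge 2$ break points.) The rotation number of a lift is $\rho(F)=\lim_{m\to\infty}\frac1m(F^m(x)-x)$, which exists and is independent of $x$, and $\rho(f)=\rho(F)\ (\mathrm{mod}\ 1)$. Two maps $f,g$ of the circle are conjugate by $h$ if $h$ is a homeomorphism of the circle with $h\circ f=g\circ h$. *)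

theory Defs
  imports "HOL-Analysis.Analysis"
begin

quotient_type circle = real / "\<lambda>x y :: real. x - y \<in> \<int>"
  morphisms rep_circle circle_of
proof (rule equivpI)
  show "reflp (\<lambda>x y :: real. x - y \<in> \<int>)"
    by (simp add: reflp_def)
  show "symp (\<lambda>x y :: real. x - y \<in> \<int>)"
    by (metis (mono_tags, lifting) Ints_minus minus_diff_eq sympI)
  show "transp (\<lambda>x y :: real. x - y \<in> \<int>)"
  proof (rule transpI)
    fix x y z :: real
    assume "x - y \<in> \<int>" "y - z \<in> \<int>"
    then have "(x - y) + (y - z) \<in> \<int>" by (rule Ints_add)
    then show "x - z \<in> \<int>" by simp
  qed
qed

text \<open>The quotient topology of \<open>\<real>/\<int>\<close>.\<close>

instantiation circle :: topological_space
begin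

definition open_circle :: "circle set \<Rightarrow> bool" where
  "open_circle U \<longleftrightarrow> open (circle_of -` U)"

instance
proof
  show "open (UNIV :: circle set)"
    by (simp add: open_circle_def)
next
  fix S T :: "circle set"
  assume "open S" "open T"
  then show "open (S \<inter> T)"
    by (simp add: open_circle_def vimage_Int open_Int)
next
  fix K :: "circle set set"
  assume "\<forall>S\<in>K. open S"
  then show "open (\<Union>K)"
    by (simp add: open_circle_def vimage_Union open_UN)
qed

end

lift_definition rotation :: "real \<Rightarrow> circle \<Rightarrow> circle" is "\<lambda>a x. x + a"
  by simp

definition is_lift :: "(real \<Rightarrow> real) \<Rightarrow> (circle \<Rightarrow> circle) \<Rightarrow> bool" where
  "is_lift F f \<longleftrightarrow>
     continuous_on UNIV F \<and> strict_mono F \<and> (\<forall>x. F (x + 1) = F x + 1) \<and>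
     (\<forall>x. f (circle_of x) = circle_of (F x))"

text \<open>A map with a lift in the above sense is automatically a homeomorphism, so none of the
  topological conditions has to be repeated here.\<close>

definition orientation_preserving_homeo :: "(circle \<Rightarrow> circle) \<Rightarrow> bool" where
  "orientation_preserving_homeo f \<longleftrightarrow> (\<exists>F. is_lift F f)"

text \<open>Neither of the next two definitions depends on the choices made: the limit exists and is the
  same for all \<open>x\<close>, and two lifts of the same map differ by an integer.\<close>

definition lift_rotation_number :: "(real \<Rightarrow> real) \<Rightarrow> real" where
  "lift_rotation_number F =
     (THE r. \<forall>x. (\<lambda>m. ((F ^^ m) x - x) / real m) \<longlonglongrightarrow> r)"

definition rotation_number :: "(circle \<Rightarrow> circle) \<Rightarrow> circle" where
  "rotation_number f = circle_of (lift_rotation_number (SOME F. is_lift F f))"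

definition derivative_jump :: "(real \<Rightarrow> real) \<Rightarrow> real \<Rightarrow> bool" where
  "derivative_jump F b \<longleftrightarrow>
     (\<exists>l r. (deriv F \<longlongrightarrow> l) (at_left b) \<and> (deriv F \<longlongrightarrow> r) (at_right b) \<and> l \<noteq> r)"

definition affine_map_on :: "real set \<Rightarrow> (real \<Rightarrow> real) \<Rightarrow> bool" where
  "affine_map_on S F \<longleftrightarrow> (\<exists>a c. \<forall>x\<in>S. F x = a * x + c)"

text \<open>The list \<open>bs\<close> is \<open>b\<^sub>1 < \<dots> < b\<^sub>n\<close>. Rotations have no break
  points and are not PWL in this sense; a single break point is impossible.\<close>

definition PWL_lift :: "(real \<Rightarrow> real) \<Rightarrow> real list \<Rightarrow> bool" where
  "PWL_lift F bs \<longleftrightarrow>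
     length bs \<ge> 2 \<and> sorted_wrt (<) bs \<and> set bs \<subseteq> {0..<1} \<and>
     (\<forall>i. Suc i < length bs \<longrightarrow> affine_map_on {bs ! i <..< bs ! Suc i} F) \<and>
     affine_map_on {last bs <..< hd bs + 1} F \<and>
     (\<forall>b\<in>set bs. derivative_jump F b)"

definition PWL :: "(circle \<Rightarrow> circle) \<Rightarrow> bool" where
  "PWL f \<longleftrightarrow> orientation_preserving_homeo f \<and> (\<exists>F bs. is_lift F f \<and> PWL_lift F bs)"

text \<open>For PWL \<open>f\<close>, this is exactly the set of points of the circle represented by the list in
  the definition above, since \<open>F\<close> has a derivative jump nowhere else in \<open>[0, 1)\<close>.\<close>

definition break_points :: "(circle \<Rightarrow> circle) \<Rightarrow> circle set" where
  "break_points f = {circle_of b | b F. 0 \<le> b \<and> b < 1 \<and> is_lift F f \<and> derivative_jump F b}"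

definition periodic_point :: "('a \<Rightarrow> 'a) \<Rightarrow> 'a \<Rightarrow> bool" where
  "periodic_point f x \<longleftrightarrow> (\<exists>n>0. (f ^^ n) x = x)"

definition conjugate_by ::
  "(circle \<Rightarrow> circle) \<Rightarrow> (circle \<Rightarrow> circle) \<Rightarrow> (circle \<Rightarrow> circle) \<Rightarrow> bool" where
  "conjugate_by h f g \<longleftrightarrow> (\<exists>h'. homeomorphism UNIV UNIV h h') \<and> h \<circ> f = g \<circ> h"

end

theory Submission
  imports Defs
begin

text \<open>
  If \<open>h\<close> conjugates \<open>f\<close> to the rotation by \<open>p / q\<close>, then \<open>f ^^ q\<close> is the identity because the
  \<open>q\<close>-th power of the rotation is, and so every point is periodic.

  Conversely, let \<open>F\<close> be a lift of \<open>f\<close> and assume that all break points are periodic. A periodic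
  orbit determines the rotation number of \<open>F\<close>
  (\<open>lift_rotation_number_periodic\<close>); it equals \<open>p' / q\<close> with \<open>p'\<close> congruent to \<open>p\<close> modulo \<open>q\<close>.
  Put \<open>G x = (F ^^ q) x - p'\<close>. Since \<open>G\<close> is monotone, it fixes every break point, whatever the
  period of that point under \<open>f\<close> (\<open>periodic_imp_funpow_fixed\<close>). As \<open>G\<close> commutes with \<open>F\<close>, the
  orbit of a point that \<open>G\<close> moves avoids the break points, so \<open>G\<close> is affine near that point. The
  break points are fixed points of \<open>G\<close>, so the gaps between fixed points are bounded intervals, and
  \<open>G\<close> is affine on each of them. An affine map fixing both ends of an interval is the identity there,
  so there are no gaps, and \<open>F ^^ q\<close> is the translation by \<open>p'\<close> (\<open>funpow_eq_translation\<close>).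

  The average \<open>H\<close> of \<open>id, F, \<dots>, F ^^ (q - 1)\<close> then satisfies \<open>H \<circ> F = H + p' / q\<close>, the sum
  telescoping. It is a lift of a homeomorphism and inherits piecewise affinity from \<open>F\<close>. If \<open>H\<close> had
  fewer than two break points it would be a translation, and so would \<open>F\<close>, contradicting that \<open>f\<close>
  has break points. So \<open>H\<close> induces a PWL conjugacy.

  Lists of break points compose badly. The proof therefore works with piecewise affinity as a
  local condition, the existence of one-sided slopes at every point, which passes to compositions
  and sums at once. The lists are recovered by compactness in \<open>piecewise_affine_PWL_lift\<close>.
\<close>

text \<open>The filter \<open>L\<close> is one of \<open>at_left x\<close>, \<open>at_right x\<close>, \<open>at x\<close>. Exact equality near \<open>x\<close> is required,
  so this is stronger than having the derivative \<open>s\<close> at \<open>x\<close>; including the value \<open>F x\<close> builds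
  one-sided continuity into the condition.\<close>

definition has_slope :: "(real \<Rightarrow> real) \<Rightarrow> real \<Rightarrow> real \<Rightarrow> real filter \<Rightarrow> bool" where
  "has_slope F s x L \<longleftrightarrow> (\<forall>\<^sub>F y in L. F y = F x + s * (y - x))"

definition piecewise_affine :: "(real \<Rightarrow> real) \<Rightarrow> bool" where
  "piecewise_affine F \<longleftrightarrow>
     (\<forall>x. (\<exists>s. has_slope F s x (at_left x)) \<and> (\<exists>s. has_slope F s x (at_right x)))"

definition degree_one_homeo :: "(real \<Rightarrow> real) \<Rightarrow> bool" where
  "degree_one_homeo F \<longleftrightarrow>
     continuous_on UNIV F \<and> strict_mono F \<and> (\<forall>x. F (x + 1) = F x + 1)"

lemma is_lift_iff:
  "is_lift F f \<longleftrightarrow> degree_one_homeo F \<and> (\<forall>x. f (circle_of x) = circle_of (F x))"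
  by (auto simp: is_lift_def degree_one_homeo_def)

section \<open>One-sided slopes\<close>

lemma has_slope_at_iff:
  "has_slope F s x (at x) \<longleftrightarrow> has_slope F s x (at_left x) \<and> has_slope F s x (at_right x)"
  by (simp add: has_slope_def eventually_at_split)

lemma has_slope_imp_DERIV:
  assumes "has_slope F s x (at x)"
  shows "(F has_real_derivative s) (at x)"
proof -
  have "\<forall>\<^sub>F y in nhds x. F y = F x + s * (y - x)"
    using assms by (simp add: has_slope_def eventually_nhds_conv_at)
  moreover have "((\<lambda>y. F x + s * (y - x)) has_real_derivative s) (at x)"
    by (auto intro!: derivative_eq_intros)
  ultimately show ?thesis
    using DERIV_cong_ev[OF refl _ refl, of F "\<lambda>y. F x + s * (y - x)" x s] by simp
qed

text \<open>On a small enough one-sided neighbourhood the germ at \<open>x\<close> describes \<open>F\<close> on an open set, so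
  the slope becomes two-sided there. Break points are isolated for this reason.\<close>

lemma has_slope_nearby:
  assumes "has_slope F s x (at x within S)" "open S"
  shows "\<forall>\<^sub>F y in at x within S. has_slope F s y (at y)"
proof -
  obtain U where U: "open U" "x \<in> U" "\<And>y. y \<in> U \<Longrightarrow> y \<noteq> x \<Longrightarrow> y \<in> S \<Longrightarrow> F y = F x + s * (y - x)"
    using assms(1) unfolding has_slope_def eventually_at_topological by metis
  have "has_slope F s y (at y)" if y: "y \<in> U" "y \<noteq> x" "y \<in> S" for y
    unfolding has_slope_def eventually_at_topological
  proof (intro exI[of _ "(U \<inter> S) - {x}"] conjI ballI impI)
    show "open (U \<inter> S - {x})" using U(1) assms(2) by blast
    show "F z = F y + s * (z - y)" if "z \<in> U \<inter> S - {x}" for z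
      using U(3)[of z] U(3)[of y] y that by (simp add: algebra_simps)
  qed (use y in auto)
  then show ?thesis
    unfolding eventually_at_topological using U(1,2) by blast
qed

lemma has_slope_deriv_tendsto:
  assumes "has_slope F s x (at x within S)" "open S"
  shows "(deriv F \<longlongrightarrow> s) (at x within S)"
proof (rule tendsto_eventually)
  show "\<forall>\<^sub>F y in at x within S. deriv F y = s"
    using has_slope_nearby[OF assms]
    by eventually_elim (rule DERIV_imp_deriv[OF has_slope_imp_DERIV])
qed

text \<open>By \<open>has_slope_nearby\<close> the one-sided slopes are the one-sided limits of the derivative, so a jump
  is the same as a disagreement between them.\<close>

lemma derivative_jump_iff:
  assumes "piecewise_affine F"
  shows "derivative_jump F x \<longleftrightarrow> (\<nexists>s. has_slope F s x (at x))"
proof -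
  obtain l r where lr: "has_slope F l x (at_left x)" "has_slope F r x (at_right x)"
    using assms unfolding piecewise_affine_def by metis
  have L: "(deriv F \<longlongrightarrow> l') (at_left x) \<longleftrightarrow> l' = l" for l'
    using has_slope_deriv_tendsto[OF lr(1)] tendsto_unique[OF trivial_limit_at_left_real] by auto
  have R: "(deriv F \<longlongrightarrow> r') (at_right x) \<longleftrightarrow> r' = r" for r'
    using has_slope_deriv_tendsto[OF lr(2)] tendsto_unique[OF trivial_limit_at_right_real] by auto
  have "has_slope F s x (at x) \<longleftrightarrow> s = l \<and> s = r" for s
    using lr L R has_slope_deriv_tendsto[of F s x "{..<x}"] has_slope_deriv_tendsto[of F s x "{x<..}"]
    unfolding has_slope_at_iff by auto
  then show ?thesis
    unfolding derivative_jump_def L R by auto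
qed

lemma has_slope_compose:
  assumes "has_slope F s x L" "has_slope G t (F x) M" "filterlim F M L"
  shows "has_slope (G \<circ> F) (t * s) x L"
proof -
  have "\<forall>\<^sub>F y in L. G (F y) = G (F x) + t * (F y - F x)"
    using assms(2,3) unfolding has_slope_def by (rule eventually_compose_filterlim)
  with assms(1) show ?thesis
    unfolding has_slope_def
  proof eventually_elim
    case (elim y)
    then have "F y - F x = s * (y - x)" by simp
    with elim(2) show ?case by simp
  qed
qed

lemma has_slope_add:
  assumes "has_slope F s x L" "has_slope G t x L"
  shows "has_slope (\<lambda>y. F y + G y) (s + t) x L"
  using assms unfolding has_slope_def by eventually_elim (simp add: algebra_simps)

lemma has_slope_scale:
  assumes "has_slope F s x L"
  shows "has_slope (\<lambda>y. a * F y) (a * s) x L"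
  using assms unfolding has_slope_def by eventually_elim (simp add: distrib_left mult.assoc)

lemma has_slope_const: "has_slope (\<lambda>y. c) 0 x L"
  by (simp add: has_slope_def)

lemma has_slope_add_const:
  "has_slope F s x L \<Longrightarrow> has_slope (\<lambda>y. F y + c) s x L"
  using has_slope_add[OF _ has_slope_const] by simp

lemma has_slope_id: "has_slope id 1 x L"
  by (simp add: has_slope_def)

lemma filterlim_strict_mono:
  fixes F :: "real \<Rightarrow> real"
  assumes "continuous_on UNIV F" "strict_mono F"
  shows "filterlim F (at_left (F x)) (at_left x)"
    and "filterlim F (at_right (F x)) (at_right x)"
    and "filterlim F (at (F x)) (at x)"
proof -
  have c: "(F \<longlongrightarrow> F x) (at x within S)" for S
    using assms(1) by (meson UNIV_I continuous_on_def subset_UNIV tendsto_within_subset)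
  show "filterlim F (at_left (F x)) (at_left x)"
    using c assms(2) by (auto simp: filterlim_at eventually_at_filter strict_mono_less strict_mono_eq)
  show "filterlim F (at_right (F x)) (at_right x)"
    using c assms(2) by (auto simp: filterlim_at eventually_at_filter strict_mono_less strict_mono_eq)
  show "filterlim F (at (F x)) (at x)"
    using c assms(2) by (auto simp: filterlim_at eventually_at_filter strict_mono_eq)
qed

lemma piecewise_affine_compose:
  assumes "piecewise_affine F" "piecewise_affine G" "continuous_on UNIV F" "strict_mono F"
  shows "piecewise_affine (G \<circ> F)"
  unfolding piecewise_affine_def
proof (intro allI conjI)
  fix x
  obtain s t where "has_slope F s x (at_left x)" "has_slope G t (F x) (at_left (F x))"
    using assms(1,2) unfolding piecewise_affine_def by blast
  then show "\<exists>s. has_slope (G \<circ> F) s x (at_left x)"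
    using has_slope_compose filterlim_strict_mono(1)[OF assms(3,4)] by blast
  obtain s t where "has_slope F s x (at_right x)" "has_slope G t (F x) (at_right (F x))"
    using assms(1,2) unfolding piecewise_affine_def by blast
  then show "\<exists>s. has_slope (G \<circ> F) s x (at_right x)"
    using has_slope_compose filterlim_strict_mono(2)[OF assms(3,4)] by blast
qed

lemma piecewise_affine_add:
  assumes "piecewise_affine F" "piecewise_affine G"
  shows "piecewise_affine (\<lambda>x. F x + G x)"
  unfolding piecewise_affine_def
proof (intro allI conjI)
  fix x
  obtain s t where "has_slope F s x (at_left x)" "has_slope G t x (at_left x)"
    using assms unfolding piecewise_affine_def by blast
  from has_slope_add[OF this] show "\<exists>s. has_slope (\<lambda>x. F x + G x) s x (at_left x)" ..
  obtain s t where "has_slope F s x (at_right x)" "has_slope G t x (at_right x)"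
    using assms unfolding piecewise_affine_def by blast
  from has_slope_add[OF this] show "\<exists>s. has_slope (\<lambda>x. F x + G x) s x (at_right x)" ..
qed

lemma piecewise_affine_const: "piecewise_affine (\<lambda>x. c)"
  using has_slope_const unfolding piecewise_affine_def by blast

lemma piecewise_affine_scale:
  assumes "piecewise_affine F"
  shows "piecewise_affine (\<lambda>x. a * F x)"
  unfolding piecewise_affine_def
proof (intro allI conjI)
  fix x
  obtain s where "has_slope F s x (at_left x)"
    using assms unfolding piecewise_affine_def by blast
  from has_slope_scale[OF this] show "\<exists>s. has_slope (\<lambda>x. a * F x) s x (at_left x)" ..
  obtain s where "has_slope F s x (at_right x)"
    using assms unfolding piecewise_affine_def by blast
  from has_slope_scale[OF this] show "\<exists>s. has_slope (\<lambda>x. a * F x) s x (at_right x)" ..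
qed

lemma piecewise_affine_sum:
  assumes "\<And>i. i \<in> I \<Longrightarrow> piecewise_affine (F i)"
  shows "piecewise_affine (\<lambda>x. \<Sum>i\<in>I. F i x)"
  using assms
  by (induction I rule: infinite_finite_induct)
    (auto intro: piecewise_affine_const piecewise_affine_add)

lemma affine_map_on_closure:
  assumes "affine_map_on S F" "continuous_on UNIV F"
  shows "affine_map_on (closure S) F"
proof -
  obtain a c where ac: "\<And>x. x \<in> S \<Longrightarrow> F x = a * x + c"
    using assms(1) unfolding affine_map_on_def by auto
  have "closed {x. F x = a * x + c}"
    using assms(2) by (intro closed_Collect_eq continuous_intros) auto
  then have "closure S \<subseteq> {x. F x = a * x + c}"
    by (intro closure_minimal) (auto simp: ac)
  then show ?thesis unfolding affine_map_on_def by auto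
qed

text \<open>The pair of slope and intercept at a point is locally constant, hence constant.\<close>

lemma affine_map_on_connected:
  assumes "connected S" "\<And>x. x \<in> S \<Longrightarrow> \<exists>s. has_slope F s x (at x)"
  shows "affine_map_on S F"
proof (cases "S = {}")
  case False
  then obtain x0 where x0: "x0 \<in> S" by auto
  \<comment> \<open>Slope and intercept of the affine function that agrees with \<open>F\<close> near \<open>x\<close>.\<close>
  define germ where "germ x = (deriv F x, F x - deriv F x * x)" for x
  have "\<forall>\<^sub>F y in at x within S. germ x = germ y" if "x \<in> S" for x
  proof -
    from assms(2)[OF \<open>x \<in> S\<close>] obtain s where s: "has_slope F s x (at x)" ..
    have [simp]: "deriv F x = s" by (rule DERIV_imp_deriv[OF has_slope_imp_DERIV[OF s]])
    have "\<forall>\<^sub>F y in at x. germ x = germ y"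
      using has_slope_nearby[OF s open_UNIV] s[unfolded has_slope_def]
    proof eventually_elim
      case (elim y)
      then have "deriv F y = s" by (intro DERIV_imp_deriv has_slope_imp_DERIV) 
      then show ?case using elim(2) by (simp add: germ_def algebra_simps)
    qed
    then show ?thesis unfolding eventually_at_filter by (rule eventually_mono) simp
  qed
  then have germ: "germ x = germ x0" if "x \<in> S" for x
    using connected_local_const[OF assms(1) that x0, of germ] by auto
  have "F x = deriv F x0 * x + (F x0 - deriv F x0 * x0)" if "x \<in> S" for x
    using germ[OF that] unfolding germ_def prod.inject by (elim conjE) (simp add: algebra_simps)
  then show ?thesis unfolding affine_map_on_def by blast
qed (simp add: affine_map_on_def)

lemma affine_map_on_interval:
  assumes "continuous_on UNIV F" "u < v" "\<And>x. u < x \<Longrightarrow> x < v \<Longrightarrow> \<exists>s. has_slope F s x (at x)"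
  shows "affine_map_on {u..v} F"
  using affine_map_on_closure[OF affine_map_on_connected[of "{u<..<v}" F]] assms by simp

section \<open>Lifts and rotation numbers\<close>

lemma degree_one_homeo_add_int:
  assumes "degree_one_homeo F"
  shows "F (x + of_int k) = F x + of_int k"
proof -
  have F1: "F (x + 1) = F x + 1" for x using assms unfolding degree_one_homeo_def by auto
  show ?thesis
  proof (induction k rule: int_induct[where k = 0])
    case (step1 i)
    then show ?case using F1[of "x + of_int i"] by (simp add: algebra_simps)
  next
    case (step2 i)
    then show ?case using F1[of "x + of_int i - 1"] by (simp add: algebra_simps)
  qed simp
qed

lemma degree_one_homeo_id: "degree_one_homeo id"
  by (simp add: degree_one_homeo_def strict_mono_def)

lemma degree_one_homeo_compose:
  assumes "degree_one_homeo F" "degree_one_homeo G"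
  shows "degree_one_homeo (F \<circ> G)"
proof -
  have "continuous_on UNIV (F \<circ> G)"
    using assms unfolding degree_one_homeo_def
    by (meson continuous_on_compose continuous_on_subset subset_UNIV)
  then show ?thesis using assms by (simp add: degree_one_homeo_def strict_mono_def)
qed

lemma degree_one_homeo_funpow:
  assumes "degree_one_homeo F"
  shows "degree_one_homeo (F ^^ n)"
proof (induction n)
  case 0
  then show ?case by (simp only: funpow.simps degree_one_homeo_id)
next
  case (Suc n)
  then show ?case by (simp only: funpow.simps degree_one_homeo_compose[OF assms])
qed

lemma circle_of_eq_iff: "circle_of x = circle_of y \<longleftrightarrow> x - y \<in> \<int>"
  by (rule circle.abs_eq_iff)

lemma circle_of_surj: obtains x where "c = circle_of x"
  using Quotient_abs_rep[OF Quotient_circle] by metis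

text \<open>The difference is continuous and takes integer values only.\<close>

lemma lifts_differ_by_int:
  assumes "is_lift F f" "is_lift G f"
  obtains k :: int where "\<And>x. F x = G x + of_int k"
proof -
  have int: "F x - G x \<in> \<int>" for x
    using assms unfolding is_lift_iff by (metis circle_of_eq_iff)
  have "continuous_on UNIV (\<lambda>x. F x - G x)"
    using assms unfolding is_lift_def by (auto intro: continuous_intros)
  then have "(\<lambda>x. F x - G x) constant_on UNIV"
  proof (rule continuous_discrete_range_constant[OF connected_UNIV])
    fix x :: real
    have "1 \<le> norm (F y - G y - (F x - G x))" if "F y - G y \<noteq> F x - G x" for y
      using that int[of x] int[of y] Ints_nonzero_abs_ge1[of "F y - G y - (F x - G x)"] by auto
    then show "\<exists>e>0. \<forall>y. y \<in> UNIV \<and> F y - G y \<noteq> F x - G x \<longrightarrow> e \<le> norm (F y - G y - (F x - G x))"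
      by (intro exI[of _ 1]) auto
  qed
  then obtain c where c: "\<And>x. F x - G x = c" unfolding constant_on_def by auto
  then obtain k where "c = of_int k" using int[of 0] Ints_cases by metis
  with c show ?thesis by (intro that[of k]) (metis diff_add_cancel add.commute)
qed

lemma lift_funpow:
  assumes "is_lift F f"
  shows "(f ^^ n) (circle_of x) = circle_of ((F ^^ n) x)"
  using assms by (induction n) (auto simp: is_lift_def)

lemma funpow_mult_periodic:
  assumes F: "degree_one_homeo F" and b: "(F ^^ n) b = b + of_int m"
  shows "(F ^^ (n * j)) b = b + of_int (int j * m)"
proof (induction j)
  case (Suc j)
  have "(F ^^ (n * Suc j)) b = (F ^^ n) ((F ^^ (n * j)) b)"
    by (simp add: funpow_add)
  also have "\<dots> = b + of_int m + of_int (int j * m)"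
    by (simp only: Suc degree_one_homeo_add_int[OF degree_one_homeo_funpow[OF F]] b)
  finally show ?case by (simp add: algebra_simps)
qed simp

text \<open>Along the periodic orbit the deviation from linear growth depends only on \<open>k\<close> modulo \<open>n\<close>. Any
  other point stays trapped between two integer translates of that orbit.\<close>

lemma periodic_orbit_bounds_deviation:
  assumes F: "degree_one_homeo F" and b: "(F ^^ n) b = b + of_int m" and n: "n > 0"
  obtains C where "\<And>k. \<bar>(F ^^ k) x - x - real k * (of_int m / real n)\<bar> \<le> C"
proof -
  define r where "r = of_int m / real n"
  define C where "C = Max ((\<lambda>i. \<bar>(F ^^ i) b - b - real i * r\<bar>) ` {..<n})"
  have C: "\<bar>(F ^^ k) b - b - real k * r\<bar> \<le> C" for k
  proof -
    define i j where "i = k mod n" and "j = k div n"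
    have k: "k = i + n * j" by (simp add: i_def j_def)
    have "(F ^^ k) b = (F ^^ i) b + of_int (int j * m)"
      unfolding k funpow_add o_apply funpow_mult_periodic[OF F b]
      by (rule degree_one_homeo_add_int[OF degree_one_homeo_funpow[OF F]])
    moreover have "real k * r = real i * r + of_int (int j * m)"
      using n by (simp add: k r_def field_simps)
    ultimately have eq: "(F ^^ k) b - b - real k * r = (F ^^ i) b - b - real i * r" by simp
    have "i \<in> {..<n}" using n by (simp add: i_def)
    then show ?thesis unfolding C_def eq by (intro Max_ge) auto
  qed
  define l where "l = \<lfloor>x - b\<rfloor>"
  have l: "b + of_int l \<le> x" "x < b + of_int (l + 1)" unfolding l_def by linarith+
  have "\<bar>(F ^^ k) x - x - real k * r\<bar> \<le> C + 1" for k
  proof -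
    have Fk: "degree_one_homeo (F ^^ k)" by (rule degree_one_homeo_funpow[OF F])
    then have mono: "strict_mono (F ^^ k)" by (simp add: degree_one_homeo_def)
    have "(F ^^ k) b + of_int l \<le> (F ^^ k) x" "(F ^^ k) x < (F ^^ k) b + of_int (l + 1)"
      using l strict_mono_less[OF mono] strict_mono_less_eq[OF mono] degree_one_homeo_add_int[OF Fk]
      by metis+
    then show ?thesis using C[of k] l by (simp add: abs_le_iff)
  qed
  then show ?thesis using that r_def by blast
qed

lemma lift_rotation_number_periodic:
  assumes "degree_one_homeo F" "(F ^^ n) b = b + of_int m" "n > 0"
  shows "lift_rotation_number F = of_int m / real n"
proof -
  define r where "r = of_int m / real n"
  have lim: "(\<lambda>k. ((F ^^ k) x - x) / real k) \<longlonglongrightarrow> r" for x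
  proof -
    obtain C where C: "\<And>k. \<bar>(F ^^ k) x - x - real k * r\<bar> \<le> C"
      using periodic_orbit_bounds_deviation[OF assms, of x] r_def by metis
    have "(\<lambda>k. ((F ^^ k) x - x) / real k - r) \<longlonglongrightarrow> 0"
    proof (rule Lim_null_comparison)
      show "\<forall>\<^sub>F k in sequentially. norm (((F ^^ k) x - x) / real k - r) \<le> C / real k"
        using eventually_gt_at_top[of 0]
      proof eventually_elim
        case (elim k)
        then have "((F ^^ k) x - x) / real k - r = ((F ^^ k) x - x - real k * r) / real k"
          by (simp add: field_simps)
        then show ?case using C[of k] by (simp add: divide_right_mono)
      qed
      show "(\<lambda>k. C / real k) \<longlonglongrightarrow> 0" by (rule lim_const_over_n)
    qed
    then show ?thesis by (simp add: LIM_zero_iff)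
  qed
  have "lift_rotation_number F = r"
    unfolding lift_rotation_number_def
    by (rule the_equality) (use lim LIMSEQ_unique in blast)+
  then show ?thesis by (simp add: r_def)
qed

text \<open>Otherwise the orbit of \<open>b\<close> moves strictly in one direction.\<close>

lemma strict_mono_periodic_fixed:
  fixes G :: "'a::linorder \<Rightarrow> 'a"
  assumes "strict_mono G" "(G ^^ n) b = b" "n > 0"
  shows "G b = b"
proof -
  have up: "b < (G ^^ Suc j) b" if "b < G b" for j
    using that by (induction j) (auto dest: strict_monoD[OF assms(1)])
  have down: "(G ^^ Suc j) b < b" if "G b < b" for j
    using that by (induction j) (auto dest: strict_monoD[OF assms(1)])
  obtain j where "n = Suc j" using assms(3) by (cases n) auto
  then show ?thesis using assms(2) up[of j] down[of j] by (metis less_irrefl linorder_neqE)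
qed

section \<open>From lifts to circle homeomorphisms\<close>

lemma degree_one_homeo_descends:
  assumes "degree_one_homeo H"
  obtains h where "is_lift H h"
proof -
  define h where "h c = circle_of (H (rep_circle c))" for c
  have "h (circle_of x) = circle_of (H x)" for x
  proof -
    have "rep_circle (circle_of x) - x \<in> \<int>"
      using Quotient_rep_abs[OF Quotient_circle, of x] by simp
    then obtain k where "rep_circle (circle_of x) = x + of_int k"
      by (metis Ints_cases add_diff_cancel_left' diff_add_cancel add.commute)
    then show ?thesis
      by (simp add: h_def degree_one_homeo_add_int[OF assms] circle_of_eq_iff)
  qed
  then show ?thesis using that assms is_lift_iff by blast
qed

text \<open>Preimages are computed in \<open>\<real>\<close>, which is how the quotient topology is defined.\<close>

lemma lift_continuous:
  assumes "is_lift H h"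
  shows "continuous_on UNIV h"
  unfolding continuous_on_open_vimage[OF open_UNIV]
proof (intro allI impI)
  fix U :: "circle set" assume "open U"
  then have "open (circle_of -` U)" by (simp add: open_circle_def)
  then have "open (H -` circle_of -` U)"
    using assms unfolding is_lift_def by (intro open_vimage[of "circle_of -` U" H]) auto
  moreover have "H -` circle_of -` U = circle_of -` (h -` U \<inter> UNIV)"
    using assms unfolding is_lift_def by auto
  ultimately show "open (h -` U \<inter> UNIV)" by (simp add: open_circle_def)
qed

lemma degree_one_homeo_inverse:
  assumes "degree_one_homeo H"
  obtains K where "degree_one_homeo K" "\<And>x. K (H x) = x" "\<And>y. H (K y) = y"
proof -
  have mono: "strict_mono H" and cont: "continuous_on UNIV H"
    using assms by (auto simp: degree_one_homeo_def)
  have "\<exists>x. H x = y" for y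
  proof -
    define l where "l = \<lfloor>y - H 0\<rfloor>"
    have "H (of_int l) \<le> y" "y \<le> H (of_int (l + 1))"
      using degree_one_homeo_add_int[OF assms, of 0 l] degree_one_homeo_add_int[OF assms, of 0 "l + 1"]
      unfolding l_def add_0 by linarith+
    then show ?thesis
      using IVT'[of H "of_int l" y "of_int (l + 1)"] continuous_on_subset[OF cont] by auto
  qed
  then obtain K where HK: "\<And>y. H (K y) = y" by metis
  have KH: "K (H x) = x" for x using strict_mono_eq[OF mono] HK by auto
  have less: "K x < K y \<longleftrightarrow> x < y" for x y using strict_mono_less[OF mono] HK by metis
  have "continuous_on UNIV K"
  proof (rule continuous_onI_mono)
    have "range K = UNIV" using KH by (metis surjI)
    then show "open (range K)" by simp
    show "K x \<le> K y" if "x \<le> y" for x y using less that by (metis leD leI)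
  qed
  moreover have "K (y + 1) = K y + 1" for y
    using assms HK KH unfolding degree_one_homeo_def by metis
  ultimately have "degree_one_homeo K" by (simp add: degree_one_homeo_def strict_mono_def less)
  then show ?thesis using that HK KH by blast
qed

lemma lift_homeomorphism:
  assumes "is_lift H h"
  obtains h' where "homeomorphism UNIV UNIV h h'"
proof -
  obtain K where K: "degree_one_homeo K" "\<And>x. K (H x) = x" "\<And>y. H (K y) = y"
    using degree_one_homeo_inverse assms is_lift_iff by metis
  obtain h' where h': "is_lift K h'" using degree_one_homeo_descends[OF K(1)] .
  have "h' (h c) = c" "h (h' c) = c" for c
    using assms h' K by (metis circle_of_surj is_lift_iff)+
  moreover from this have "range h = UNIV" "range h' = UNIV" by (metis surjI)+
  ultimately show ?thesis
    using lift_continuous[OF assms] lift_continuous[OF h']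
    by (intro that[of h']) (simp add: homeomorphism_def)
qed

section \<open>Slopes and lists of break points\<close>

lemma affine_map_on_has_slope:
  assumes "affine_map_on {u<..<v} F" "continuous_on UNIV F"
  shows "u < x \<Longrightarrow> x \<le> v \<Longrightarrow> \<exists>s. has_slope F s x (at_left x)"
    and "u \<le> x \<Longrightarrow> x < v \<Longrightarrow> \<exists>s. has_slope F s x (at_right x)"
proof -
  have aff: "\<exists>a. \<forall>z\<in>{u..v}. F z = F x + a * (z - x)" if "u < v" "x \<in> {u..v}"
  proof -
    have "affine_map_on {u..v} F" using affine_map_on_closure[OF assms] that by simp
    then obtain a c where ac: "\<And>z. z \<in> {u..v} \<Longrightarrow> F z = a * z + c" unfolding affine_map_on_def by auto
    have "F z = F x + a * (z - x)" if "z \<in> {u..v}" for z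
      unfolding ac[OF that] ac[OF \<open>x \<in> {u..v}\<close>] by (simp add: algebra_simps)
    then show ?thesis by blast
  qed
  show "\<exists>s. has_slope F s x (at_left x)" if x: "u < x" "x \<le> v"
  proof -
    have "u < v" "x \<in> {u..v}" using x by auto
    then obtain a where a: "\<And>z. z \<in> {u..v} \<Longrightarrow> F z = F x + a * (z - x)" using aff by blast
    have "has_slope F a x (at_left x)"
      unfolding has_slope_def eventually_at_left_field
    proof (intro exI[of _ u] conjI allI impI)
      show "F z = F x + a * (z - x)" if "u < z" "z < x" for z
        by (rule a) (use that x in auto)
    qed (rule x)
    then show ?thesis ..
  qed
  show "\<exists>s. has_slope F s x (at_right x)" if x: "u \<le> x" "x < v"
  proof -
    have "u < v" "x \<in> {u..v}" using x by auto
    then obtain a where a: "\<And>z. z \<in> {u..v} \<Longrightarrow> F z = F x + a * (z - x)" using aff by blast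
    have "has_slope F a x (at_right x)"
      unfolding has_slope_def eventually_at_right_field
    proof (intro exI[of _ v] conjI allI impI)
      show "F z = F x + a * (z - x)" if "x < z" "z < v" for z
        by (rule a) (use that x in auto)
    qed (rule x)
    then show ?thesis ..
  qed
qed

text \<open>Apply \<open>has_slope_compose\<close> to the integer translation, with which \<open>F\<close> commutes.\<close>

lemma has_slope_shift:
  assumes "degree_one_homeo F"
  shows "has_slope F s (x + of_int k) (at_left (x + of_int k)) \<Longrightarrow> has_slope F s x (at_left x)"
    and "has_slope F s (x + of_int k) (at_right (x + of_int k)) \<Longrightarrow> has_slope F s x (at_right x)"
    and "has_slope F s (x + of_int k) (at (x + of_int k)) \<Longrightarrow> has_slope F s x (at x)"
proof -
  define T :: "real \<Rightarrow> real" where "T y = y + of_int k" for y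
  have "continuous_on UNIV T" "strict_mono T"
    unfolding T_def by (auto intro!: continuous_intros simp: strict_mono_def)
  note lim = filterlim_strict_mono[OF this, of x]
  have *: "has_slope F s x L"
    if "has_slope F s (x + of_int k) M" "filterlim T M L" for L M
  proof -
    have "has_slope T 1 x L" by (simp add: has_slope_def T_def)
    then have "has_slope (F \<circ> T) s x L"
      using has_slope_compose[of T 1 x L F s M] that by (simp add: T_def)
    then have "has_slope (\<lambda>y. (F \<circ> T) y + - of_int k) s x L" by (rule has_slope_add_const)
    moreover have "(\<lambda>y. (F \<circ> T) y + - of_int k) = F"
      unfolding T_def comp_apply degree_one_homeo_add_int[OF assms] by simp
    ultimately show ?thesis by simp
  qed
  show "has_slope F s (x + of_int k) (at_left (x + of_int k)) \<Longrightarrow> has_slope F s x (at_left x)"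
    by (rule *) (use lim(1) in \<open>simp_all add: T_def\<close>)
  show "has_slope F s (x + of_int k) (at_right (x + of_int k)) \<Longrightarrow> has_slope F s x (at_right x)"
    by (rule *) (use lim(2) in \<open>simp_all add: T_def\<close>)
  show "has_slope F s (x + of_int k) (at (x + of_int k)) \<Longrightarrow> has_slope F s x (at x)"
    by (rule *) (use lim(3) in \<open>simp_all add: T_def\<close>)
qed

lemma list_switch_point:
  assumes "xs \<noteq> []" "\<not> P (hd xs)" "P (last xs)"
  obtains i where "Suc i < length xs" "\<not> P (xs ! i)" "P (xs ! Suc i)"
proof -
  define j where "j = (LEAST j. P (xs ! j))"
  have last: "P (xs ! (length xs - 1))" using assms by (simp add: last_conv_nth)
  have j: "P (xs ! j)" "j \<le> length xs - 1"
    unfolding j_def using LeastI[of "\<lambda>j. P (xs ! j)", OF last] Least_le[of "\<lambda>j. P (xs ! j)", OF last]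
    by blast+
  obtain i where i: "j = Suc i"
    using j(1) assms(1,2) by (cases j) (auto simp: hd_conv_nth)
  then have "\<not> P (xs ! i)"
    using not_less_Least[of i "\<lambda>j. P (xs ! j)"] j_def by simp
  moreover have "length xs > 0" using assms(1) by simp
  then have "Suc i < length xs" using j(2) i by linarith
  ultimately show ?thesis using that[of i] j(1) i by blast
qed

text \<open>Closing up the list by \<open>hd bs + 1\<close> covers one period by intervals of affinity; which side of
  \<open>x\<close> is considered decides at which end such an interval must be closed.\<close>

lemma PWL_lift_piecewise_affine:
  assumes "degree_one_homeo F" "PWL_lift F bs"
  shows "piecewise_affine F"
proof -
  have cont: "continuous_on UNIV F" using assms(1) by (simp add: degree_one_homeo_def)
  define cs where "cs = bs @ [hd bs + 1]"
  have bs: "bs \<noteq> []" using assms(2) by (auto simp: PWL_lift_def)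
  have aff: "affine_map_on {cs ! i <..< cs ! Suc i} F" if "Suc i < length cs" for i
  proof (cases "Suc i < length bs")
    case True
    then show ?thesis using assms(2) by (simp add: PWL_lift_def cs_def nth_append)
  next
    case False
    then have i: "i = length bs - 1" "Suc i = length bs" using that bs by (auto simp: cs_def)
    then have "cs ! i = last bs" "cs ! Suc i = hd bs + 1"
      using bs by (auto simp: cs_def nth_append last_conv_nth)
    then show ?thesis using assms(2) by (simp add: PWL_lift_def)
  qed
  have cs: "cs \<noteq> []" "hd cs = hd bs" "last cs = hd bs + 1" using bs by (auto simp: cs_def)
  have L: "\<exists>s. has_slope F s x (at_left x)" if x: "hd bs < x" "x \<le> hd bs + 1" for x
  proof -
    obtain i where "Suc i < length cs" "\<not> x \<le> cs ! i" "x \<le> cs ! Suc i"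
      using list_switch_point[of cs "\<lambda>c. x \<le> c"] cs x by auto
    then show ?thesis using affine_map_on_has_slope(1)[OF aff cont] by auto
  qed
  have R: "\<exists>s. has_slope F s x (at_right x)" if x: "hd bs \<le> x" "x < hd bs + 1" for x
  proof -
    obtain i where "Suc i < length cs" "\<not> x < cs ! i" "x < cs ! Suc i"
      using list_switch_point[of cs "\<lambda>c. x < c"] cs x by auto
    then show ?thesis using affine_map_on_has_slope(2)[OF aff cont] by auto
  qed
  show ?thesis
    unfolding piecewise_affine_def
  proof (intro allI conjI)
    fix x
    \<comment> \<open>Left slopes are known on \<open>(hd bs, hd bs + 1]\<close>, right slopes on \<open>[hd bs, hd bs + 1)\<close>; this
      decides between ceiling and floor.\<close>
    define k where "k = 1 - \<lceil>x - hd bs\<rceil>"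
    have "hd bs < x + of_int k" "x + of_int k \<le> hd bs + 1" unfolding k_def by linarith+
    then show "\<exists>s. has_slope F s x (at_left x)"
      using L has_slope_shift(1)[OF assms(1)] by blast
    define l where "l = - \<lfloor>x - hd bs\<rfloor>"
    have "hd bs \<le> x + of_int l" "x + of_int l < hd bs + 1" unfolding l_def by linarith+
    then show "\<exists>s. has_slope F s x (at_right x)"
      using R has_slope_shift(2)[OF assms(1)] by blast
  qed
qed

text \<open>Jumps do not accumulate, by \<open>has_slope_nearby\<close> on either side of a limit point.\<close>

lemma finite_derivative_jumps:
  assumes "piecewise_affine F" "compact A"
  shows "finite (A \<inter> {x. derivative_jump F x})"
proof (rule finite_not_islimpt_in_compact[OF assms(2)])
  fix x
  obtain l r where "has_slope F l x (at_left x)" "has_slope F r x (at_right x)"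
    using assms unfolding piecewise_affine_def by metis
  from this[THEN has_slope_nearby] have "\<forall>\<^sub>F y in at x. \<exists>s. has_slope F s y (at y)"
    unfolding eventually_at_split by (auto elim: eventually_mono)
  then show "\<not> x islimpt {x. derivative_jump F x}"
    by (simp add: islimpt_iff_eventually derivative_jump_iff[OF assms(1)])
qed

text \<open>On a full period without interior jumps \<open>F\<close> is affine, and degree one forces the slope 1.\<close>

lemma at_most_one_jump_imp_translation:
  assumes F: "degree_one_homeo F" and pa: "piecewise_affine F"
    and one: "\<And>x. u < x \<Longrightarrow> x < u + 1 \<Longrightarrow> \<not> derivative_jump F x"
  obtains c where "\<And>x. F x = x + c"
proof -
  have "affine_map_on {u..u+1} F"
    using F one derivative_jump_iff[OF pa]
    by (intro affine_map_on_interval) (auto simp: degree_one_homeo_def)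
  then obtain a c where ac: "\<And>x. x \<in> {u..u+1} \<Longrightarrow> F x = a * x + c"
    unfolding affine_map_on_def by auto
  have "F (u + 1) = F u + 1" using F by (simp add: degree_one_homeo_def)
  then have a: "a = 1" using ac[of u] ac[of "u + 1"] by (simp add: algebra_simps)
  have "F x = x + c" for x
  proof -
    define k where "k = \<lfloor>x - u\<rfloor>"
    have "x - of_int k \<in> {u..u+1}" unfolding k_def by (simp, linarith)
    from ac[OF this] show ?thesis
      using degree_one_homeo_add_int[OF F, of "x - of_int k" k] a by simp
  qed
  then show ?thesis by (rule that)
qed

text \<open>The list is the sorted list of the jumps in \<open>[0, 1)\<close>. Nontriviality is what provides at least
  two entries, by \<open>at_most_one_jump_imp_translation\<close>.\<close>

lemma piecewise_affine_PWL_lift: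
  assumes F: "degree_one_homeo F" and pa: "piecewise_affine F"
    and nontrivial: "\<nexists>c. \<forall>x. F x = x + c"
  obtains bs where "PWL_lift F bs"
proof -
  define K where "K = {0..<1} \<inter> {x. derivative_jump F x}"
  have "finite K"
    using finite_derivative_jumps[OF pa, of "{0..1}"] K_def by (auto elim: finite_subset[rotated])
  define bs where "bs = sorted_list_of_set K"
  have set: "set bs = K" using \<open>finite K\<close> by (simp add: bs_def)
  have sorted: "sorted_wrt (<) bs" by (simp add: bs_def)
  have smooth: "affine_map_on {u<..<v} F" if "\<And>x. u < x \<Longrightarrow> x < v \<Longrightarrow> \<not> derivative_jump F x" for u v
    using that derivative_jump_iff[OF pa] by (intro affine_map_on_connected) auto
  have shift: "derivative_jump F (x - 1)" if "derivative_jump F x" for x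
    using that has_slope_shift(3)[OF F, of _ x "-1"] unfolding derivative_jump_iff[OF pa] by auto
  \<comment> \<open>Inclusion instead of equality covers zero jumps and one jump together.\<close>
  have K_ge: "\<not> K \<subseteq> {b}" if b: "0 \<le> b" "b < 1" for b
  proof
    assume K: "K \<subseteq> {b}"
    have "\<not> derivative_jump F x" if x: "b < x" "x < b + 1" for x
    proof
      assume j: "derivative_jump F x"
      show False
      proof (cases "x < 1")
        case True
        then have "x \<in> K" using j x b by (simp add: K_def)
        then show False using K x by auto
      next
        case False
        then have "x - 1 \<in> K" using shift[OF j] x b by (simp add: K_def)
        then show False using K x by auto
      qed
    qed
    then show False using at_most_one_jump_imp_translation[OF F pa, of b] nontrivial by blast
  qed
  have len: "length bs \<ge> 2"
  proof (rule ccontr)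
    assume "\<not> length bs \<ge> 2"
    then consider "bs = []" | b where "bs = [b]"
      by (cases bs; cases "tl bs") auto
    then show False
    proof cases
      case 1
      then show False using set K_ge[of 0] by simp
    next
      case 2
      then have "K = {b}" using set by simp
      moreover from this have "0 \<le> b" "b < 1" by (auto simp: K_def)
      ultimately show False using K_ge[of b] by simp
    qed
  qed
  have bs: "bs \<noteq> []" using len by auto
  have least: "hd bs \<le> b" and greatest: "b \<le> last bs" if "b \<in> K" for b
  proof -
    obtain i where i: "i < length bs" "b = bs ! i" using \<open>b \<in> K\<close> set by (metis in_set_conv_nth)
    have "sorted bs" by (simp add: bs_def)
    then show "hd bs \<le> b" "b \<le> last bs"
      using i bs by (auto simp: hd_conv_nth last_conv_nth intro: sorted_nth_mono)
  qed
  have hl: "hd bs \<in> K" "last bs \<in> K" using bs set by auto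
  have "affine_map_on {bs ! i <..< bs ! Suc i} F" if i: "Suc i < length bs" for i
  proof (rule smooth)
    fix x assume x: "bs ! i < x" "x < bs ! Suc i"
    have "bs ! i \<in> K" "bs ! Suc i \<in> K" using set i by auto
    show "\<not> derivative_jump F x"
    proof
      assume "derivative_jump F x"
      then have "x \<in> K" using x \<open>bs ! i \<in> K\<close> \<open>bs ! Suc i \<in> K\<close> by (auto simp: K_def)
      then obtain j where j: "j < length bs" "x = bs ! j" using set by (metis in_set_conv_nth)
      have "i < j" "j < Suc i"
        using x j i sorted_nth_mono[of bs j i] sorted_nth_mono[of bs "Suc i" j]
        by (force simp: bs_def not_less[symmetric])+
      then show False by simp
    qed
  qed
  moreover have "affine_map_on {last bs <..< hd bs + 1} F"
  proof (rule smooth)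
    fix x assume x: "last bs < x" "x < hd bs + 1"
    show "\<not> derivative_jump F x"
    proof
      assume j: "derivative_jump F x"
      show False
      proof (cases "x < 1")
        case True
        then have "x \<in> K" using j x hl by (simp add: K_def)
        then show False using greatest x by force
      next
        case False
        then have "x - 1 \<in> K" using shift[OF j] x hl by (simp add: K_def)
        then show False using least x by force
      qed
    qed
  qed
  ultimately have "PWL_lift F bs"
    using len sorted set unfolding PWL_lift_def by (auto simp: K_def)
  then show ?thesis by (rule that)
qed

section \<open>Iterates when the break points are periodic\<close>

lemma has_slope_funpow:
  assumes "degree_one_homeo F" "\<And>j. j < n \<Longrightarrow> \<exists>s. has_slope F s ((F ^^ j) x) (at ((F ^^ j) x))"
  shows "\<exists>s. has_slope (F ^^ n) s x (at x)"
  using assms(2)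
proof (induction n)
  case 0
  then show ?case using has_slope_id unfolding funpow.simps by blast
next
  case (Suc n)
  have "degree_one_homeo (F ^^ n)" by (rule degree_one_homeo_funpow[OF assms(1)])
  then have "filterlim (F ^^ n) (at ((F ^^ n) x)) (at x)"
    by (intro filterlim_strict_mono) (auto simp: degree_one_homeo_def)
  moreover obtain s t where "has_slope (F ^^ n) s x (at x)" "has_slope F t ((F ^^ n) x) (at ((F ^^ n) x))"
    using Suc by (metis lessI less_SucI)
  ultimately show ?case unfolding funpow.simps using has_slope_compose by blast
qed

lemma piecewise_affine_funpow:
  assumes "degree_one_homeo F" "piecewise_affine F"
  shows "piecewise_affine (F ^^ n)"
proof (induction n)
  case 0
  then show ?case using has_slope_id unfolding funpow.simps piecewise_affine_def by blast
next
  case (Suc n)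
  have "degree_one_homeo (F ^^ n)" by (rule degree_one_homeo_funpow[OF assms(1)])
  then show ?case
    using piecewise_affine_compose[OF Suc assms(2)] unfolding degree_one_homeo_def funpow.simps by blast
qed

text \<open>Between two consecutive fixed points \<open>G\<close> is affine, and an affine map with two fixed points is
  the identity.\<close>

lemma eq_id_if_smooth_off_fixed_points:
  assumes cont: "continuous_on UNIV (G :: real \<Rightarrow> real)"
    and smooth: "\<And>x. G x \<noteq> x \<Longrightarrow> \<exists>s. has_slope G s x (at x)"
    and below: "\<And>x. \<exists>y\<le>x. G y = y" and above: "\<And>x. \<exists>y\<ge>x. G y = y"
  shows "G x = x"
proof (rule ccontr)
  assume x: "G x \<noteq> x"
  have closed: "closed {y. G y = y}"
    using cont by (intro closed_Collect_eq continuous_intros) auto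
  \<comment> \<open>The gap of the fixed point set around \<open>x\<close>.\<close>
  define u v where "u = Sup ({y. G y = y} \<inter> {..x})" and "v = Inf ({y. G y = y} \<inter> {x..})"
  have bdd: "bdd_above ({y. G y = y} \<inter> {..x})" "bdd_below ({y. G y = y} \<inter> {x..})" by auto
  have "u \<in> {y. G y = y} \<inter> {..x}"
    unfolding u_def using below[of x] closed bdd by (intro closed_contains_Sup) auto
  moreover have "v \<in> {y. G y = y} \<inter> {x..}"
    unfolding v_def using above[of x] closed bdd by (intro closed_contains_Inf) auto
  ultimately have uv: "G u = u" "u < x" "G v = v" "x < v"
    using x by (auto simp: order.strict_iff_order)
  have "G y \<noteq> y" if y: "u < y" "y < v" for y
  proof
    assume "G y = y"
    then show False
      using y cSup_upper[OF _ bdd(1), of y] cInf_lower[OF _ bdd(2), of y] u_def v_def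
      by (cases "y \<le> x") auto
  qed
  then have "affine_map_on {u..v} G"
    using cont uv smooth by (intro affine_map_on_interval) auto
  then obtain a c where ac: "\<And>y. y \<in> {u..v} \<Longrightarrow> G y = a * y + c"
    unfolding affine_map_on_def by auto
  have "a * u + c = u" "a * v + c = v" using ac[of u] ac[of v] uv by auto
  then have "(a - 1) * (v - u) = 0" by (simp add: algebra_simps)
  then have "a = 1" using uv by simp
  then show False using \<open>a * u + c = u\<close> ac[of x] uv x by simp
qed

text \<open>A point whose orbit meets a break point is itself fixed by \<open>F ^^ q - p\<close>, because this map
  commutes with \<open>F\<close>. The jump at \<open>b0\<close> and its integer translates supply fixed points on both sides
  of any point.\<close>

lemma funpow_eq_translation:
  assumes F: "degree_one_homeo F" and pa: "piecewise_affine F"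
    and fixed: "\<And>b. derivative_jump F b \<Longrightarrow> (F ^^ q) b = b + of_int p"
    and jump: "derivative_jump F b0"
  shows "(F ^^ q) x = x + of_int p"
proof -
  have Fn: "degree_one_homeo (F ^^ n)" for n by (rule degree_one_homeo_funpow[OF F])
  define G where "G x = (F ^^ q) x + - of_int p" for x
  have "G x = x"
  proof (rule eq_id_if_smooth_off_fixed_points)
    show "continuous_on UNIV G"
      using Fn unfolding G_def degree_one_homeo_def by (intro continuous_intros) auto
    show "\<exists>s. has_slope G s x (at x)" if x: "G x \<noteq> x" for x
    proof -
      have "\<not> derivative_jump F ((F ^^ j) x)" for j
      proof
        assume "derivative_jump F ((F ^^ j) x)"
        then have "(F ^^ q) ((F ^^ j) x) = (F ^^ j) x + of_int p" by (rule fixed)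
        then have "(F ^^ j) ((F ^^ q) x) = (F ^^ j) (x + of_int p)"
          unfolding degree_one_homeo_add_int[OF Fn]
          by (metis add.commute comp_apply funpow_add)
        moreover have "strict_mono (F ^^ j)" using Fn by (simp add: degree_one_homeo_def)
        ultimately have "(F ^^ q) x = x + of_int p" by (simp add: strict_mono_eq)
        then show False using x by (simp add: G_def)
      qed
      then obtain s where "has_slope (F ^^ q) s x (at x)"
        using has_slope_funpow[OF F, of q x] derivative_jump_iff[OF pa] by blast
      from has_slope_add_const[OF this, of "- of_int p"] show ?thesis unfolding G_def by blast
    qed
    have G: "G (b0 + of_int k) = b0 + of_int k" for k
      unfolding G_def degree_one_homeo_add_int[OF Fn] fixed[OF jump] by simp
    show "\<exists>y\<le>x. G y = y" for x
      using G[of "\<lfloor>x - b0\<rfloor>"] by (intro exI[of _ "b0 + of_int \<lfloor>x - b0\<rfloor>"] conjI) linarith+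
    show "\<exists>y\<ge>x. G y = y" for x
      using G[of "\<lceil>x - b0\<rceil>"] by (intro exI[of _ "b0 + of_int \<lceil>x - b0\<rceil>"] conjI) linarith+
  qed
  then show ?thesis by (simp add: G_def)
qed

text \<open>Iterating \<open>G = F ^^ q - p\<close> for \<open>n\<close> steps moves \<open>b\<close> by \<open>m q - p n = 0\<close>, so \<open>b\<close> is periodic, hence
  fixed, under the monotone map \<open>G\<close>. In particular \<open>p / q\<close> may be any fraction equal to \<open>m / n\<close>.\<close>

lemma periodic_imp_funpow_fixed:
  assumes F: "degree_one_homeo F" and b: "(F ^^ n) b = b + of_int m" and n: "n > 0"
    and rat: "of_int m * real q = of_int p * real n"
  shows "(F ^^ q) b = b + of_int p"
proof -
  have Fn: "degree_one_homeo (F ^^ n)" for n by (rule degree_one_homeo_funpow[OF F])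
  define G where "G x = (F ^^ q) x - of_int p" for x
  have Gj: "(G ^^ j) x = (F ^^ (q * j)) x - of_int (p * int j)" for j x
  proof (induction j)
    case (Suc j)
    have "(G ^^ Suc j) x = (F ^^ q) ((F ^^ (q * j)) x + of_int (- (p * int j))) - of_int p"
      by (simp add: Suc G_def)
    also have "\<dots> = (F ^^ (q * Suc j)) x - of_int (p * int (Suc j))"
      unfolding degree_one_homeo_add_int[OF Fn] by (simp add: funpow_add algebra_simps)
    finally show ?case .
  qed simp
  have "(G ^^ n) b = b"
    using rat funpow_mult_periodic[OF F b, of q] unfolding Gj by (simp add: mult.commute)
  moreover have "strict_mono G"
    using Fn[of q] unfolding G_def degree_one_homeo_def by (auto simp: strict_mono_def)
  ultimately have "G b = b" using n by (intro strict_mono_periodic_fixed)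
  then show ?thesis by (simp add: G_def)
qed

section \<open>Averaging over an orbit\<close>

definition orbit_average :: "(real \<Rightarrow> real) \<Rightarrow> nat \<Rightarrow> real \<Rightarrow> real" where
  "orbit_average F q x = inverse (real q) * (\<Sum>i<q. (F ^^ i) x)"

lemma orbit_average_degree_one:
  assumes F: "degree_one_homeo F" and q: "q > 0"
  shows "degree_one_homeo (orbit_average F q)"
proof -
  have Fn: "degree_one_homeo (F ^^ n)" for n by (rule degree_one_homeo_funpow[OF F])
  have "continuous_on UNIV (orbit_average F q)"
    unfolding orbit_average_def using Fn
    by (intro continuous_intros) (simp add: degree_one_homeo_def)
  moreover have "strict_mono (orbit_average F q)"
    unfolding strict_mono_def
  proof (intro allI impI)
    fix x y :: real assume "x < y"
    then have "(F ^^ i) x < (F ^^ i) y" for i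
      using Fn by (auto simp: degree_one_homeo_def strict_mono_def)
    then have "(\<Sum>i<q. (F ^^ i) x) < (\<Sum>i<q. (F ^^ i) y)"
      using q by (intro sum_strict_mono) auto
    then show "orbit_average F q x < orbit_average F q y"
      using q by (simp add: orbit_average_def)
  qed
  moreover have "orbit_average F q (x + 1) = orbit_average F q x + 1" for x
  proof -
    have "(F ^^ i) (x + 1) = (F ^^ i) x + 1" for i using Fn by (simp add: degree_one_homeo_def)
    then show ?thesis using q by (simp add: orbit_average_def sum.distrib distrib_left)
  qed
  ultimately show ?thesis by (simp add: degree_one_homeo_def)
qed

text \<open>Replacing \<open>x\<close> by \<open>F x\<close> drops the first term \<open>x\<close> of the sum and adds \<open>(F ^^ q) x\<close>.\<close>

lemma orbit_average_conjugates:
  assumes "(F ^^ q) x = x + c" "q > 0"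
  shows "orbit_average F q (F x) = orbit_average F q x + c / real q"
proof -
  have "(\<Sum>i<q. (F ^^ i) (F x)) = (\<Sum>i<q. (F ^^ Suc i) x)"
    by (simp add: funpow_swap1)
  also have "\<dots> = (\<Sum>i<q. (F ^^ i) x) + c"
    using sum.lessThan_Suc_shift[of "\<lambda>i. (F ^^ i) x" q] sum.lessThan_Suc[of "\<lambda>i. (F ^^ i) x" q] assms(1)
    by simp
  finally show ?thesis by (simp add: orbit_average_def divide_inverse distrib_left mult.commute)
qed

lemma orbit_average_piecewise_affine:
  assumes "degree_one_homeo F" "piecewise_affine F"
  shows "piecewise_affine (orbit_average F q)"
proof -
  have "piecewise_affine (\<lambda>x. \<Sum>i<q. (F ^^ i) x)"
    by (intro piecewise_affine_sum piecewise_affine_funpow assms)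
  then show ?thesis
    unfolding orbit_average_def[abs_def] by (rule piecewise_affine_scale)
qed

section \<open>Conjugacy to a rotation\<close>

lemma rotation_circle_of: "rotation a (circle_of x) = circle_of (x + a)"
  by (rule rotation.abs_eq)

lemma rotation_cong:
  assumes "circle_of a = circle_of b"
  shows "rotation a = rotation b"
proof
  fix c obtain x where "c = circle_of x" using circle_of_surj .
  then show "rotation a c = rotation b c"
    using assms by (simp add: rotation_circle_of circle_of_eq_iff)
qed

lemma rotation_funpow: "(rotation a ^^ n) (circle_of x) = circle_of (x + real n * a)"
  by (induction n) (auto simp: rotation_circle_of algebra_simps)

lemma conjugate_to_rotation_periodic:
  assumes "conjugate_by h f (rotation (real_of_int p / real q))" "q > 0"
  shows "periodic_point f c"
proof -
  let ?r = "rotation (real_of_int p / real q)"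
  obtain h' where "homeomorphism UNIV UNIV h h'" and conj: "\<And>c. h (f c) = ?r (h c)"
    using assms(1) unfolding conjugate_by_def by (metis comp_apply)
  then have inv: "h' (h c) = c" for c by (simp add: homeomorphism_def)
  have n: "h ((f ^^ n) c) = (?r ^^ n) (h c)" for n
    by (induction n) (auto simp: conj)
  obtain x where x: "h c = circle_of x" using circle_of_surj .
  have "h ((f ^^ q) c) = h c"
    using assms(2) by (simp add: n x rotation_funpow circle_of_eq_iff)
  then have "(f ^^ q) c = c" using inv by metis
  then show ?thesis using assms(2) unfolding periodic_point_def by blast
qed

text \<open>Break points are indexed by \<open>[0, 1)\<close>, so \<open>b\<close> is reduced modulo 1 first.\<close>

lemma jump_circle_of_break_point:
  assumes "is_lift F f" "piecewise_affine F" "derivative_jump F b"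
  shows "circle_of b \<in> break_points f"
proof -
  have F: "degree_one_homeo F" using assms(1) by (simp add: is_lift_iff)
  have "derivative_jump F (frac b)"
    using assms(3) has_slope_shift(3)[OF F, of _ b "- \<lfloor>b\<rfloor>"]
    by (auto simp: derivative_jump_iff[OF assms(2)] frac_def)
  moreover have "circle_of b = circle_of (frac b)"
    by (simp add: circle_of_eq_iff frac_def)
  ultimately show ?thesis
    unfolding break_points_def using assms(1) frac_ge_0[of b] frac_lt_1[of b] by blast
qed

text \<open>The lift to work with is the one chosen in the definition of \<open>rotation_number\<close>; it differs by an
  integer from the lift that carries the list of break points, and both have the same jumps.\<close>

lemma periodic_breaks_imp_conjugate:
  assumes pwl: "PWL f" and q: "q > 0"
    and rot: "rotation_number f = circle_of (real_of_int p / real q)"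
    and per: "\<And>c. c \<in> break_points f \<Longrightarrow> periodic_point f c"
  obtains h where "PWL h" "conjugate_by h f (rotation (real_of_int p / real q))"
proof -
  obtain F0 bs where F0: "is_lift F0 f" "PWL_lift F0 bs" using pwl unfolding PWL_def by auto
  define F where "F = (SOME F. is_lift F f)"
  have lift: "is_lift F f" unfolding F_def using F0(1) by (rule someI[where P = "\<lambda>F. is_lift F f"])
  then have F: "degree_one_homeo F" and fF: "\<And>x. f (circle_of x) = circle_of (F x)"
    by (auto simp: is_lift_iff)
  obtain k where k: "\<And>x. F x = F0 x + of_int k" using lifts_differ_by_int[OF lift F0(1)] by blast
  have pa0: "piecewise_affine F0"
    using PWL_lift_piecewise_affine F0 is_lift_iff by blast
  have F_eq: "F = (\<lambda>x. F0 x + of_int k)" using k by auto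
  have pa: "piecewise_affine F"
    unfolding F_eq by (intro piecewise_affine_add piecewise_affine_const pa0)
  obtain b0 where "derivative_jump F0 b0"
    using F0(2) unfolding PWL_lift_def by (cases bs) auto
  moreover have "F0 = (\<lambda>x. F x + - of_int k)" using k by auto
  ultimately have jump: "derivative_jump F b0"
    unfolding derivative_jump_iff[OF pa0] derivative_jump_iff[OF pa]
    using has_slope_add_const[of F _ b0 "at b0" "- of_int k"] by auto
  define r where "r = lift_rotation_number F"
  have orbit: "\<exists>n m. n > 0 \<and> (F ^^ n) b = b + of_int m \<and> r = of_int m / real n"
    if b: "derivative_jump F b" for b
  proof -
    obtain n where n: "n > 0" "(f ^^ n) (circle_of b) = circle_of b"
      using per[OF jump_circle_of_break_point[OF lift pa b]] unfolding periodic_point_def by auto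
    then have "(F ^^ n) b - b \<in> \<int>" by (simp add: lift_funpow[OF lift] circle_of_eq_iff)
    then obtain m where "(F ^^ n) b = b + of_int m"
      by (metis Ints_cases diff_add_cancel add.commute)
    then show ?thesis using lift_rotation_number_periodic[OF F _ n(1)] n(1) r_def by blast
  qed
  have "r - real_of_int p / real q \<in> \<int>"
    using rot by (simp add: rotation_number_def F_def[symmetric] r_def circle_of_eq_iff)
  then obtain N where "r - real_of_int p / real q = of_int N" by (auto elim: Ints_cases)
  \<comment> \<open>The rotation number of the lift is known only modulo 1; absorbing \<open>N\<close> into the numerator gives
    an exact value with the denominator \<open>q\<close>.\<close>
  define p' where "p' = p + N * int q"
  have r: "r = of_int p' / real q"
    using \<open>r - _ = _\<close> q by (simp add: p'_def field_simps)
  have "(F ^^ q) b = b + of_int p'" if b: "derivative_jump F b" for b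
  proof -
    obtain n m where nm: "n > 0" "(F ^^ n) b = b + of_int m" "r = of_int m / real n"
      using orbit[OF b] by auto
    then have "of_int m * real q = of_int p' * real n"
      using r q by (simp add: field_simps)
    then show ?thesis using periodic_imp_funpow_fixed[OF F] nm by blast
  qed
  then have Fq: "(F ^^ q) x = x + of_int p'" for x
    using funpow_eq_translation[OF F pa _ jump] by blast
  define H where "H = orbit_average F q"
  have H: "degree_one_homeo H" "piecewise_affine H"
    unfolding H_def by (rule orbit_average_degree_one[OF F q] orbit_average_piecewise_affine[OF F pa])+
  have HF: "H (F x) = H x + r" for x
    unfolding H_def r by (rule orbit_average_conjugates[OF Fq q])
  have "\<nexists>c. \<forall>x. H x = x + c"
  proof
    assume "\<exists>c. \<forall>x. H x = x + c"
    then have "F x = x + r" for x using HF[of x] by auto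
    then have "has_slope F 1 b0 (at b0)" by (simp add: has_slope_def)
    then show False using jump derivative_jump_iff[OF pa] by blast
  qed
  then obtain cs where cs: "PWL_lift H cs" using piecewise_affine_PWL_lift[OF H] by blast
  obtain h where h: "is_lift H h" using degree_one_homeo_descends[OF H(1)] .
  have "h \<circ> f = rotation r \<circ> h"
  proof
    fix c obtain x where "c = circle_of x" using circle_of_surj .
    then show "(h \<circ> f) c = (rotation r \<circ> h) c"
      using h by (simp add: is_lift_iff fF HF rotation_circle_of)
  qed
  moreover have "rotation r = rotation (real_of_int p / real q)"
    by (rule rotation_cong) (simp add: circle_of_eq_iff \<open>r - _ = _\<close>)
  moreover obtain h' where "homeomorphism UNIV UNIV h h'" using lift_homeomorphism[OF h] .
  ultimately have "conjugate_by h f (rotation (real_of_int p / real q))"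
    unfolding conjugate_by_def by auto
  moreover have "PWL h" unfolding PWL_def orientation_preserving_homeo_def using h cs by blast
  ultimately show ?thesis using that by blast
qed

theorem theorem2p2:
  fixes f :: "circle \<Rightarrow> circle" and p :: int and q :: nat
  assumes "orientation_preserving_homeo f"
    and "PWL f"
    and "q > 0"
    and "rotation_number f = circle_of (real_of_int p / real q)"
  shows "(\<exists>h. PWL h \<and> conjugate_by h f (rotation (real_of_int p / real q)))
         \<longleftrightarrow> (\<forall>c\<in>break_points f. periodic_point f c)"
  using conjugate_to_rotation_periodic periodic_breaks_imp_conjugate[OF assms(2-4)] assms(3)
  by metis

end
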